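(* Let $\varepsilon'_0$ and $\varepsilon_i$, $i\in\mathbb{Z}$, be i.i.d. real random variables with characteristic function $\varphi$, and let $X_k=g(\dots,\varepsilon_{k-1},\varepsilon_k)$, $k\in\mathbb{Z}$, be a well-defined stationary process ($g$ measurable). Let $0<\alpha\le2$. Assume that $X_k=\varepsilon_k+Y_{k-1}$ for all $k$, where $Y_{k-1}$ is measurable with respect to $\xi_{k-1}=(\dots,\varepsilon_{k-2},\varepsilon_{k-1})$, that $$\int_{\mathbb{R}}|\varphi(t)|^2(1+t^2)|t|^\alpha\,dt<\infty,$$ and that $$\sum_{k=0}^{\infty}\|X_k-X_k^*\|_\alpha^{\alpha/2}<\infty.$$ Then $$\sum_{k=1}^{\infty}\Big[\int_{\mathbb{R}}(1+\theta^2)\,\big\|\varphi_k(\theta\mid\xi_0)-\varphi_k(\theta\mid\xi_0^* )\big\|^2\,d\theta\Big]^{1/2}<\infty.$$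
   Context: Notation: $\xi_k=(\dots,\varepsilon_{k-1},\varepsilon_k)$; for $k\ge0$, $\xi_k^*=(\xi_{-1},\varepsilon'_0,\varepsilon_1,\dots,\varepsilon_k)$ and $X_k^*=g(\xi_k^* )$ (the coupled version of $X_k$ with $\varepsilon_0$ replaced by $\varepsilon'_0$). $\|Z\|_p=(\mathbb{E}|Z|^p)^{1/p}$ and $\|Z\|=\|Z\|_2$. The conditional characteristic function is $\varphi_k(\theta\mid\xi_0)=\mathbb{E}(e^{\sqrt{-1}\theta X_k}\mid\xi_0)$, viewed as a function of the history $\xi_0$, and $\varphi_k(\theta\mid\xi_0^* )$ is that function evaluated at $\xi_0^*$. *)

theory Defs
  imports "HOL-Probability.Probability"
begin

text \<open>History xi_k = (..., eps_(k-1), eps_k), encoded as a sequence indexed by lag j: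
  (xi k) j = eps (k - j).\<close>
definition hist :: "(int \<Rightarrow> 'a \<Rightarrow> real) \<Rightarrow> int \<Rightarrow> 'a \<Rightarrow> (nat \<Rightarrow> real)" where
  "hist eps k \<omega> = (\<lambda>j. eps (k - int j) \<omega>)"

definition hist_star :: "(int \<Rightarrow> 'a \<Rightarrow> real) \<Rightarrow> ('a \<Rightarrow> real) \<Rightarrow> int \<Rightarrow> 'a \<Rightarrow> (nat \<Rightarrow> real)" where
  "hist_star eps eps' k \<omega> = (\<lambda>j. if k - int j = 0 then eps' \<omega> else eps (k - int j) \<omega>)"

definition gen_sigma :: "'a measure \<Rightarrow> ('a \<Rightarrow> nat \<Rightarrow> real) \<Rightarrow> 'a measure" where
  "gen_sigma M Z = vimage_algebra (space M) Z (PiM UNIV (\<lambda>_. borel))"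

definition complex_cond_exp :: "'a measure \<Rightarrow> 'a measure \<Rightarrow> ('a \<Rightarrow> complex) \<Rightarrow> 'a \<Rightarrow> complex" where
  "complex_cond_exp M F f = (\<lambda>\<omega>. Complex (real_cond_exp M F (\<lambda>x. Re (f x)) \<omega>)
                                          (real_cond_exp M F (\<lambda>x. Im (f x)) \<omega>))"

end

theory Submission
  imports Defs
begin

text \<open>
  For \<open>k \<ge> 1\<close> the innovation \<open>\<epsilon>\<^sub>k\<close> is independent of \<open>\<xi>\<^sub>k\<^sub>-\<^sub>1\<close>, so that
  \<open>\<phi>\<^sub>k(\<theta> | \<xi>\<^sub>0) = \<phi>(\<theta>) E(exp(i \<theta> Y\<^sub>k\<^sub>-\<^sub>1) | \<xi>\<^sub>0)\<close>, and the coupled history obeys the same identity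
  because it has the same law. Integrating out the common innovations \<open>\<epsilon>\<^sub>1, \<dots>, \<epsilon>\<^sub>k\<^sub>-\<^sub>1\<close>,
  Jensen's inequality and \<open>|exp(i a) - exp(i b)|\<^sup>2 \<le> 4 |a - b|\<^sup>\<alpha>\<close> bound the squared norm of the
  difference by \<open>4 |\<phi>(\<theta>)|\<^sup>2 |\<theta>|\<^sup>\<alpha> E|X\<^sub>k - X\<^sub>k\<^sup>*|\<^sup>\<alpha>\<close>. Integrating over \<open>\<theta>\<close> leaves a constant times
  \<open>E|X\<^sub>k - X\<^sub>k\<^sup>*|\<^sup>\<alpha>\<close>, whose square roots are summable by hypothesis.
\<close>

section \<open>Measurability with respect to a generated sigma-algebra\<close>

lemma INF_of_rat_greater:
  fixes a :: real
  shows "(INF q. if a < of_rat q then ereal (of_rat q) else \<infinity>) = ereal a"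
proof (rule antisym)
  show "(INF q. if a < of_rat q then ereal (of_rat q) else \<infinity>) \<le> ereal a"
  proof (rule ereal_le_epsilon2)
    fix e :: real assume "0 < e"
    then obtain q where q: "a < of_rat q" "of_rat q < a + e"
      using of_rat_dense[of a "a + e"] by auto
    have "(INF q. if a < of_rat q then ereal (of_rat q) else \<infinity>) \<le> ereal (of_rat q)"
      using q by (intro INF_lower2[of q]) simp_all
    also have "\<dots> \<le> ereal a + ereal e"
      using q by simp
    finally show "(INF q. if a < of_rat q then ereal (of_rat q) else \<infinity>) \<le> ereal a + ereal e" .
  qed
qed (rule INF_greatest, simp)

lemma borel_measurable_vimage_algebraE:
  fixes f :: "'a \<Rightarrow> real"
  assumes f: "f \<in> borel_measurable (vimage_algebra X Z N)" and Z: "Z \<in> X \<rightarrow> space N"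
  obtains y where "y \<in> borel_measurable N" "\<And>x. x \<in> X \<Longrightarrow> f x = y (Z x)"
proof -
  have "\<exists>B. B \<in> sets N \<and> {x \<in> X. f x < of_rat q} = Z -` B \<inter> X" for q
  proof -
    have "{x \<in> space (vimage_algebra X Z N). f x < of_rat q} \<in> sets (vimage_algebra X Z N)"
      using f by measurable
    then show ?thesis
      unfolding sets_vimage_algebra2[OF Z] by auto
  qed
  then obtain B where B: "\<And>q. B q \<in> sets N" "\<And>q. {x \<in> X. f x < of_rat q} = Z -` B q \<inter> X"
    by metis
  let ?y = "\<lambda>z. real_of_ereal (INF q. if z \<in> B q then ereal (of_rat q) else \<infinity>)"
  have "?y \<in> borel_measurable N"
    using B(1) by measurable
  moreover have "f x = ?y (Z x)" if "x \<in> X" for x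
  proof -
    have "Z x \<in> B q \<longleftrightarrow> f x < of_rat q" for q
      using B(2)[of q] that by auto
    then show ?thesis
      by (simp only: INF_of_rat_greater real_of_ereal.simps)
  qed
  ultimately show ?thesis by (rule that)
qed

lemma (in prob_space) sigma_finite_subalgebra_vimage_algebra:
  assumes Z: "random_variable S Z"
  shows "sigma_finite_subalgebra M (vimage_algebra (space M) Z S)"
proof -
  have "subalgebra M (vimage_algebra (space M) Z S)"
    unfolding subalgebra_def using sets_image_in_sets[OF refl Z] by simp
  then interpret finite_measure_subalgebra M "vimage_algebra (space M) Z S"
    by unfold_locales
  show ?thesis ..
qed

section \<open>Independence of random variables\<close>

text \<open>The constant \<^const>\<open>prob_space.indep_var\<close> forces both variables to take values in the same type;
  this is the heterogeneous counterpart.\<close>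
definition (in prob_space) indep_pair ::
    "'b measure \<Rightarrow> ('a \<Rightarrow> 'b) \<Rightarrow> 'c measure \<Rightarrow> ('a \<Rightarrow> 'c) \<Rightarrow> bool" where
  "indep_pair S Z T V \<longleftrightarrow> random_variable S Z \<and> random_variable T V \<and>
    distr M S Z \<Otimes>\<^sub>M distr M T V = distr M (S \<Otimes>\<^sub>M T) (\<lambda>\<omega>. (Z \<omega>, V \<omega>))"

context prob_space
begin

lemma indep_pair_rv1: "indep_pair S Z T V \<Longrightarrow> random_variable S Z"
  and indep_pair_rv2: "indep_pair S Z T V \<Longrightarrow> random_variable T V"
  and indep_pair_distr: "indep_pair S Z T V \<Longrightarrow>
    distr M S Z \<Otimes>\<^sub>M distr M T V = distr M (S \<Otimes>\<^sub>M T) (\<lambda>\<omega>. (Z \<omega>, V \<omega>))"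
  by (simp_all add: indep_pair_def)

lemma indep_pair_eq_indep_var: "indep_pair S Z T V \<longleftrightarrow> indep_var S Z T V"
  by (simp add: indep_pair_def indep_var_distribution_eq)

lemma indep_pair_compose:
  assumes indep: "indep_pair S Z T V"
    and [measurable]: "f \<in> S \<rightarrow>\<^sub>M S'" "g \<in> T \<rightarrow>\<^sub>M T'"
  shows "indep_pair S' (\<lambda>\<omega>. f (Z \<omega>)) T' (\<lambda>\<omega>. g (V \<omega>))"
proof -
  note indep_pair_rv1[OF indep, measurable] indep_pair_rv2[OF indep, measurable]
  have "prob_space (distr M T' (\<lambda>\<omega>. g (V \<omega>)))"
    by (rule prob_space_distr) simp
  then have "sigma_finite_measure (distr (distr M T V) T' g)"
    by (simp add: distr_distr comp_def prob_space_imp_sigma_finite)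
  then have "distr (distr M S Z) S' f \<Otimes>\<^sub>M distr (distr M T V) T' g
      = distr (distr M S Z \<Otimes>\<^sub>M distr M T V) (S' \<Otimes>\<^sub>M T') (\<lambda>(x, y). (f x, g y))"
    by (intro pair_measure_distr) simp_all
  then show ?thesis
    by (simp add: indep_pair_def indep_pair_distr[OF indep] distr_distr comp_def)
qed

lemma indep_pair_blocks:
  assumes "indep_vars N X I" "A \<inter> B = {}" "A \<subseteq> I" "B \<subseteq> I"
    and "f \<in> PiM A N \<rightarrow>\<^sub>M S" "g \<in> PiM B N \<rightarrow>\<^sub>M T"
  shows "indep_pair S (\<lambda>\<omega>. f (restrict (\<lambda>i. X i \<omega>) A)) T (\<lambda>\<omega>. g (restrict (\<lambda>i. X i \<omega>) B))"
proof -
  have "indep_pair (PiM A N) (\<lambda>\<omega>. restrict (\<lambda>i. X i \<omega>) A) (PiM B N) (\<lambda>\<omega>. restrict (\<lambda>i. X i \<omega>) B)"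
    using indep_var_restrict[OF assms(1-4)] by (simp add: indep_pair_eq_indep_var)
  then show ?thesis
    using assms(5,6) by (rule indep_pair_compose)
qed

lemma nn_integral_indep_pair:
  assumes indep: "indep_pair S Z T V" and [measurable]: "f \<in> borel_measurable (S \<Otimes>\<^sub>M T)"
  shows "(\<integral>\<^sup>+\<omega>. f (Z \<omega>, V \<omega>) \<partial>M) = (\<integral>\<^sup>+\<omega>. \<integral>\<^sup>+\<omega>'. f (Z \<omega>, V \<omega>') \<partial>M \<partial>M)"
proof -
  note indep_pair_rv1[OF indep, measurable] indep_pair_rv2[OF indep, measurable]
  interpret DV: prob_space "distr M T V" by (rule prob_space_distr) simp
  have "(\<integral>\<^sup>+\<omega>. f (Z \<omega>, V \<omega>) \<partial>M) = (\<integral>\<^sup>+p. f p \<partial>(distr M S Z \<Otimes>\<^sub>M distr M T V))"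
    unfolding indep_pair_distr[OF indep] by (subst nn_integral_distr) auto
  also have "\<dots> = (\<integral>\<^sup>+x. \<integral>\<^sup>+v. f (x, v) \<partial>distr M T V \<partial>distr M S Z)"
    by (rule DV.nn_integral_fst[symmetric]) simp
  also have "\<dots> = (\<integral>\<^sup>+x. \<integral>\<^sup>+\<omega>'. f (x, V \<omega>') \<partial>M \<partial>distr M S Z)"
    by (intro nn_integral_cong nn_integral_distr) auto
  also have "\<dots> = (\<integral>\<^sup>+\<omega>. \<integral>\<^sup>+\<omega>'. f (Z \<omega>, V \<omega>') \<partial>M \<partial>M)"
    by (subst nn_integral_distr) auto
  finally show ?thesis .
qed

lemma
  fixes f :: "'b \<times> 'c \<Rightarrow> 'd::{banach, second_countable_topology}"
  assumes indep: "indep_pair S Z T V" and [measurable]: "f \<in> borel_measurable (S \<Otimes>\<^sub>M T)"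
    and integrable: "integrable M (\<lambda>\<omega>. f (Z \<omega>, V \<omega>))"
  shows AE_integrable_indep_pair: "AE \<omega> in M. integrable M (\<lambda>\<omega>'. f (Z \<omega>, V \<omega>'))" (is ?section)
    and integrable_integral_indep_pair: "integrable M (\<lambda>\<omega>. \<integral>\<omega>'. f (Z \<omega>, V \<omega>') \<partial>M)" (is ?integrable)
    and integral_indep_pair: "(\<integral>\<omega>. f (Z \<omega>, V \<omega>) \<partial>M) = (\<integral>\<omega>. \<integral>\<omega>'. f (Z \<omega>, V \<omega>') \<partial>M \<partial>M)" (is ?integral)
proof -
  note indep_pair_rv1[OF indep, measurable] indep_pair_rv2[OF indep, measurable]
  interpret DZ: prob_space "distr M S Z" by (rule prob_space_distr) simp
  interpret DV: prob_space "distr M T V" by (rule prob_space_distr) simp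
  interpret DZV: pair_prob_space "distr M S Z" "distr M T V" ..
  have integrable_joint: "integrable (distr M S Z \<Otimes>\<^sub>M distr M T V) f"
    unfolding indep_pair_distr[OF indep] using integrable by (subst integrable_distr_eq) auto
  have section_integral: "(\<integral>v. f (x, v) \<partial>distr M T V) = (\<integral>\<omega>'. f (x, V \<omega>') \<partial>M)"
    if "x \<in> space S" for x
    using that by (subst integral_distr) auto
  have "AE x in distr M S Z. integrable (distr M T V) (\<lambda>v. f (x, v))"
    by (rule DZV.AE_integrable_fst'[OF integrable_joint])
  then have "AE \<omega> in M. integrable (distr M T V) (\<lambda>v. f (Z \<omega>, v))"
    by (rule AE_distrD[rotated]) simp
  then show ?section
    using AE_space by eventually_elim (simp add: integrable_distr_eq measurable_space)
  have "integrable (distr M S Z) (\<lambda>x. \<integral>\<omega>'. f (x, V \<omega>') \<partial>M)"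
    using DZV.integrable_fst'[OF integrable_joint]
    by (rule Bochner_Integration.integrable_cong[THEN iffD1, rotated 2])
      (simp_all add: section_integral)
  then show ?integrable
    by (subst (asm) integrable_distr_eq) auto
  have "(\<integral>\<omega>. f (Z \<omega>, V \<omega>) \<partial>M) = (\<integral>p. f p \<partial>(distr M S Z \<Otimes>\<^sub>M distr M T V))"
    unfolding indep_pair_distr[OF indep] by (subst integral_distr) auto
  also have "\<dots> = (\<integral>x. \<integral>v. f (x, v) \<partial>distr M T V \<partial>distr M S Z)"
    by (rule DZV.integral_fst'[OF integrable_joint, symmetric])
  also have "\<dots> = (\<integral>x. \<integral>\<omega>'. f (x, V \<omega>') \<partial>M \<partial>distr M S Z)"
    by (intro Bochner_Integration.integral_cong) (simp_all add: section_integral)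
  also have "\<dots> = (\<integral>\<omega>. \<integral>\<omega>'. f (Z \<omega>, V \<omega>') \<partial>M \<partial>M)"
    by (subst integral_distr) auto
  finally show ?integral .
qed

lemma indep_vars_reindex:
  assumes indep: "indep_vars N X I" and f: "inj_on f J" "f ` J \<subseteq> I"
  shows "indep_vars (\<lambda>j. N (f j)) (\<lambda>j. X (f j)) J"
proof -
  define F where "F i = {X i -` A \<inter> space M |A. A \<in> sets (N i)}" for i
  have rv_X: "random_variable (N i) (X i)" if "i \<in> I" for i
    using indep that by (simp add: indep_vars_def2)
  have indep_F: "indep_sets F I"
    using indep by (simp add: indep_vars_def2 F_def[abs_def])
  have "indep_sets (\<lambda>j. F (f j)) J"
  proof (rule indep_setsI)
    show "F (f j) \<subseteq> events" if "j \<in> J" for j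
      using indep_F f(2) that by (auto simp: indep_sets_def)
    fix A K assume K: "K \<noteq> {}" "K \<subseteq> J" "finite K" and A: "\<forall>j\<in>K. A j \<in> F (f j)"
    have inj: "inj_on f K"
      using f(1) K(2) by (rule inj_on_subset)
    define A' where "A' i = A (the_inv_into K f i)" for i
    have A': "A' (f j) = A j" if "j \<in> K" for j
      using that by (simp add: A'_def the_inv_into_f_f[OF inj])
    have "prob (\<Inter>j\<in>K. A j) = prob (\<Inter>i\<in>f ` K. A' i)"
      by (simp add: A')
    also have "\<dots> = (\<Prod>i\<in>f ` K. prob (A' i))"
      using K f(2) A by (intro indep_setsD[OF indep_F]) (auto simp: A')
    also have "\<dots> = (\<Prod>j\<in>K. prob (A j))"
      by (simp add: prod.reindex[OF inj] A')
    finally show "prob (\<Inter>j\<in>K. A j) = (\<Prod>j\<in>K. prob (A j))" .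
  qed
  then show ?thesis
    using rv_X f(2) by (auto simp: indep_vars_def2 F_def)
qed

end

section \<open>Conditional expectation of a function of two independent variables\<close>

lemma (in prob_space) real_cond_exp_indep_pair:
  fixes f :: "'b \<times> 'c \<Rightarrow> real"
  assumes indep: "indep_pair S Z T V" and f[measurable]: "f \<in> borel_measurable (S \<Otimes>\<^sub>M T)"
    and integrable: "integrable M (\<lambda>\<omega>. f (Z \<omega>, V \<omega>))"
  shows "AE \<omega> in M. real_cond_exp M (vimage_algebra (space M) Z S) (\<lambda>\<omega>. f (Z \<omega>, V \<omega>)) \<omega>
    = (\<integral>\<omega>'. f (Z \<omega>, V \<omega>') \<partial>M)"
proof -
  note Z[measurable] = indep_pair_rv1[OF indep] and indep_pair_rv2[OF indep, measurable]
  note integrable_section_integral = integrable_integral_indep_pair[OF indep f integrable]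
  let ?F = "vimage_algebra (space M) Z S"
  interpret sigma_finite_subalgebra M ?F
    by (rule sigma_finite_subalgebra_vimage_algebra) simp
  have Z_space: "Z \<in> space M \<rightarrow> space S"
    using measurable_space[OF Z] by blast
  then have [measurable]: "Z \<in> ?F \<rightarrow>\<^sub>M S"
    by (rule measurable_vimage_algebra1)
  show ?thesis
  proof (rule real_cond_exp_charact[OF _ integrable integrable_section_integral])
    show "(\<lambda>\<omega>. \<integral>\<omega>'. f (Z \<omega>, V \<omega>') \<partial>M) \<in> borel_measurable ?F" by measurable
    fix A assume "A \<in> sets ?F"
    then obtain C where C[measurable]: "C \<in> sets S" and A: "A = Z -` C \<inter> space M"
      by (auto simp: sets_vimage_algebra2[OF Z_space])
    have set_integral: "(\<integral>\<omega>\<in>A. u \<omega> \<partial>M) = (\<integral>\<omega>. indicator C (Z \<omega>) * u \<omega> \<partial>M)" for u :: "'a \<Rightarrow> real"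
      unfolding set_lebesgue_integral_def
      by (intro Bochner_Integration.integral_cong) (auto simp: A indicator_def)
    have "integrable M (\<lambda>\<omega>. indicator C (Z \<omega>) * f (Z \<omega>, V \<omega>))"
      using integrable by (rule Bochner_Integration.integrable_bound) (auto simp: indicator_def)
    then have "(\<integral>\<omega>. indicator C (Z \<omega>) * f (Z \<omega>, V \<omega>) \<partial>M)
        = (\<integral>\<omega>. \<integral>\<omega>'. indicator C (Z \<omega>) * f (Z \<omega>, V \<omega>') \<partial>M \<partial>M)"
      using integral_indep_pair[OF indep, of "\<lambda>p. indicator C (fst p) * f p"] by simp
    then show "(\<integral>\<omega>\<in>A. f (Z \<omega>, V \<omega>) \<partial>M) = (\<integral>\<omega>\<in>A. (\<integral>\<omega>'. f (Z \<omega>, V \<omega>') \<partial>M) \<partial>M)"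
      by (simp add: set_integral)
  qed
qed

lemma (in prob_space) complex_cond_exp_indep_pair:
  fixes f :: "'b \<times> 'c \<Rightarrow> complex"
  assumes indep: "indep_pair S Z T V" and f[measurable]: "f \<in> borel_measurable (S \<Otimes>\<^sub>M T)"
    and integrable: "integrable M (\<lambda>\<omega>. f (Z \<omega>, V \<omega>))"
  shows "AE \<omega> in M. complex_cond_exp M (vimage_algebra (space M) Z S) (\<lambda>\<omega>. f (Z \<omega>, V \<omega>)) \<omega>
    = (\<integral>\<omega>'. f (Z \<omega>, V \<omega>') \<partial>M)"
proof -
  have "AE \<omega> in M. real_cond_exp M (vimage_algebra (space M) Z S) (\<lambda>\<omega>. Re (f (Z \<omega>, V \<omega>))) \<omega>
    = (\<integral>\<omega>'. Re (f (Z \<omega>, V \<omega>')) \<partial>M)"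
    using indep integrable by (intro real_cond_exp_indep_pair) auto
  moreover have "AE \<omega> in M. real_cond_exp M (vimage_algebra (space M) Z S) (\<lambda>\<omega>. Im (f (Z \<omega>, V \<omega>))) \<omega>
    = (\<integral>\<omega>'. Im (f (Z \<omega>, V \<omega>')) \<partial>M)"
    using indep integrable by (intro real_cond_exp_indep_pair) auto
  ultimately show ?thesis
    using AE_integrable_indep_pair[OF indep f integrable]
    by eventually_elim (simp add: complex_cond_exp_def complex_eq_iff)
qed

lemma (in sigma_finite_subalgebra) complex_cond_exp_cong:
  assumes AE_eq: "AE x in M. f x = g x"
    and [measurable]: "f \<in> borel_measurable M" "g \<in> borel_measurable M"
  shows "AE x in M. complex_cond_exp M F f x = complex_cond_exp M F g x"
proof -
  have "AE x in M. real_cond_exp M F (\<lambda>x. Re (f x)) x = real_cond_exp M F (\<lambda>x. Re (g x)) x"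
    using AE_eq by (intro real_cond_exp_cong) auto
  moreover have "AE x in M. real_cond_exp M F (\<lambda>x. Im (f x)) x = real_cond_exp M F (\<lambda>x. Im (g x)) x"
    using AE_eq by (intro real_cond_exp_cong) auto
  ultimately show ?thesis
    by eventually_elim (simp add: complex_cond_exp_def)
qed

section \<open>Characteristic functions of nearby random variables\<close>

lemma borel_measurable_cis[measurable]: "cis \<in> borel_measurable borel"
  by (intro borel_measurable_continuous_onI continuous_intros)

lemma cmod_cis_diff: "cmod (cis a - cis b) = 2 * \<bar>sin ((a - b) / 2)\<bar>"
proof -
  have "cis a - cis b = cis b * (cis (a - b) - 1)"
    by (simp add: algebra_simps cis_mult)
  then have "cmod (cis a - cis b) = cmod (cis (a - b) - 1)"
    by (simp add: norm_mult)
  also have "\<dots> = 2 * \<bar>sin ((a - b) / 2)\<bar>"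
    unfolding cis_conv_exp by (rule dist_exp_i_1)
  finally show ?thesis .
qed

lemma cmod_cis_diff_square_le:
  assumes "0 \<le> \<alpha>" "\<alpha> \<le> 2"
  shows "(cmod (cis a - cis b))\<^sup>2 \<le> 4 * \<bar>a - b\<bar> powr \<alpha>"
proof -
  let ?s = "\<bar>sin ((a - b) / 2)\<bar>"
  have "?s\<^sup>2 = ?s powr 2"
    by simp
  also have "\<dots> \<le> ?s powr \<alpha>"
    using assms by (intro powr_mono') auto
  also have "\<dots> \<le> \<bar>a - b\<bar> powr \<alpha>"
    using assms abs_sin_x_le_abs_x[of "(a - b) / 2"] by (intro powr_mono2) auto
  finally show ?thesis
    by (simp add: cmod_cis_diff power_mult_distrib)
qed

lemma (in prob_space) norm_expectation_square_le:
  fixes f :: "'a \<Rightarrow> 'b::{banach, second_countable_topology}"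
  assumes [measurable]: "f \<in> borel_measurable M"
  shows "ennreal ((norm (expectation f))\<^sup>2) \<le> (\<integral>\<^sup>+x. ennreal ((norm (f x))\<^sup>2) \<partial>M)"
proof (cases "integrable M f")
  case True
  have "ennreal ((norm (expectation f))\<^sup>2) = (ennreal (norm (expectation f)))\<^sup>2"
    by (simp add: ennreal_power)
  also have "\<dots> \<le> (\<integral>\<^sup>+x. ennreal (norm (f x)) * 1 \<partial>M)\<^sup>2"
    using integral_norm_bound_ennreal[OF True] by (simp add: power_mono)
  also have "\<dots> \<le> (\<integral>\<^sup>+x. (ennreal (norm (f x)))\<^sup>2 \<partial>M) * (\<integral>\<^sup>+x. 1\<^sup>2 \<partial>M)"
    by (rule Cauchy_Schwarz_nn_integral) simp_all
  finally show ?thesis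
    by (simp add: ennreal_power emeasure_space_1)
qed (simp add: not_integrable_integral_eq)

lemma (in prob_space) char_distr_eq_expectation_cis:
  assumes [measurable]: "random_variable borel U"
  shows "char (distr M borel U) \<theta> = expectation (\<lambda>\<omega>. cis (\<theta> * U \<omega>))"
  by (simp add: char_def integral_distr cis_conv_exp)

lemma (in prob_space) integrable_cis:
  assumes [measurable]: "random_variable borel U"
  shows "integrable M (\<lambda>\<omega>. cis (U \<omega>))"
  by (rule integrable_const_bound[of _ 1]) auto

lemma (in prob_space) cmod_char_diff_square_le:
  assumes [measurable]: "random_variable borel U" "random_variable borel U'" and \<alpha>: "0 \<le> \<alpha>" "\<alpha> \<le> 2"
  shows "ennreal ((cmod (char (distr M borel U) \<theta> - char (distr M borel U') \<theta>))\<^sup>2)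
    \<le> ennreal (4 * \<bar>\<theta>\<bar> powr \<alpha>) * (\<integral>\<^sup>+\<omega>. ennreal (\<bar>U \<omega> - U' \<omega>\<bar> powr \<alpha>) \<partial>M)"
proof -
  have "char (distr M borel U) \<theta> - char (distr M borel U') \<theta>
      = expectation (\<lambda>\<omega>. cis (\<theta> * U \<omega>) - cis (\<theta> * U' \<omega>))"
    by (simp add: char_distr_eq_expectation_cis integrable_cis)
  then have "ennreal ((cmod (char (distr M borel U) \<theta> - char (distr M borel U') \<theta>))\<^sup>2)
      \<le> (\<integral>\<^sup>+\<omega>. ennreal ((cmod (cis (\<theta> * U \<omega>) - cis (\<theta> * U' \<omega>)))\<^sup>2) \<partial>M)"
    by (simp add: norm_expectation_square_le)
  also have "\<dots> \<le> (\<integral>\<^sup>+\<omega>. ennreal (4 * \<bar>\<theta>\<bar> powr \<alpha>) * ennreal (\<bar>U \<omega> - U' \<omega>\<bar> powr \<alpha>) \<partial>M)"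
  proof (rule nn_integral_mono)
    fix \<omega>
    have "(cmod (cis (\<theta> * U \<omega>) - cis (\<theta> * U' \<omega>)))\<^sup>2 \<le> 4 * \<bar>\<theta> * U \<omega> - \<theta> * U' \<omega>\<bar> powr \<alpha>"
      using \<alpha> by (rule cmod_cis_diff_square_le)
    also have "\<dots> = (4 * \<bar>\<theta>\<bar> powr \<alpha>) * \<bar>U \<omega> - U' \<omega>\<bar> powr \<alpha>"
      by (simp add: powr_mult abs_mult flip: right_diff_distrib)
    finally show "ennreal ((cmod (cis (\<theta> * U \<omega>) - cis (\<theta> * U' \<omega>)))\<^sup>2)
        \<le> ennreal (4 * \<bar>\<theta>\<bar> powr \<alpha>) * ennreal (\<bar>U \<omega> - U' \<omega>\<bar> powr \<alpha>)"
      by (simp add: ennreal_leI flip: ennreal_mult)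
  qed
  also have "\<dots> = ennreal (4 * \<bar>\<theta>\<bar> powr \<alpha>) * (\<integral>\<^sup>+\<omega>. ennreal (\<bar>U \<omega> - U' \<omega>\<bar> powr \<alpha>) \<partial>M)"
    by (rule nn_integral_cmult) measurable
  finally show ?thesis .
qed

section \<open>Histories of i.i.d. innovations and their coupled versions\<close>

abbreviation sequences :: "(nat \<Rightarrow> real) measure" where
  "sequences \<equiv> PiM UNIV (\<lambda>_. borel)"

text \<open>Histories are indexed by lag, whereas \<open>v\<close> lists the later innovations in chronological order.\<close>
definition extend_history :: "nat \<Rightarrow> (nat \<Rightarrow> real) \<Rightarrow> (nat \<Rightarrow> real) \<Rightarrow> nat \<Rightarrow> real" where
  "extend_history m x v = (\<lambda>j. if j < m then v (m - Suc j) else x (j - m))"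

definition plus_innovation :: "((nat \<Rightarrow> real) \<Rightarrow> real) \<Rightarrow> (nat \<Rightarrow> real) \<Rightarrow> real" where
  "plus_innovation y x = x 0 + y (\<lambda>j. x (Suc j))"

lemma in_space_sequences[measurable]: "x \<in> space sequences"
  by (simp add: space_PiM)

lemma measurable_sequencesI:
  assumes "\<And>j. (\<lambda>x. f x j) \<in> borel_measurable N"
  shows "f \<in> N \<rightarrow>\<^sub>M sequences"
  using assms by (rule measurable_PiM_single') simp

lemma measurable_sequences_component: "(\<lambda>x. x j) \<in> borel_measurable sequences"
  by (rule measurable_component_singleton) simp

lemma measurable_extend_history[measurable (raw)]:
  assumes f: "f \<in> N \<rightarrow>\<^sub>M sequences" and g: "g \<in> N \<rightarrow>\<^sub>M sequences"
  shows "(\<lambda>x. extend_history m (f x) (g x)) \<in> N \<rightarrow>\<^sub>M sequences"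
proof (rule measurable_sequencesI)
  show "(\<lambda>x. extend_history m (f x) (g x) j) \<in> borel_measurable N" for j
    using measurable_compose[OF f measurable_sequences_component[of "j - m"]]
      measurable_compose[OF g measurable_sequences_component[of "m - Suc j"]]
    by (cases "j < m") (simp_all add: extend_history_def)
qed

lemma measurable_plus_innovation[measurable]:
  assumes y: "y \<in> borel_measurable sequences"
  shows "plus_innovation y \<in> borel_measurable sequences"
proof -
  have "(\<lambda>x j. x (Suc j)) \<in> sequences \<rightarrow>\<^sub>M sequences"
    by (rule measurable_sequencesI) (rule measurable_sequences_component)
  then have "(\<lambda>x. y (\<lambda>j. x (Suc j))) \<in> borel_measurable sequences"
    using y by (rule measurable_compose)
  with measurable_sequences_component[of 0] show ?thesis
    unfolding plus_innovation_def by (rule borel_measurable_add)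
qed

lemma plus_innovation_extend_history:
  "plus_innovation y (extend_history (Suc m) x v) = v m + y (extend_history m x v)"
proof -
  have "(\<lambda>j. extend_history (Suc m) x v (Suc j)) = extend_history m x v"
    by (simp add: extend_history_def fun_eq_iff)
  then show ?thesis
    by (simp only: plus_innovation_def) (simp add: extend_history_def)
qed

lemma plus_innovation_hist: "plus_innovation y (hist eps k \<omega>) = eps k \<omega> + y (hist eps (k - 1) \<omega>)"
proof -
  have "(\<lambda>j. hist eps k \<omega> (Suc j)) = hist eps (k - 1) \<omega>"
    by (simp add: hist_def fun_eq_iff diff_diff_eq)
  then show ?thesis
    by (simp only: plus_innovation_def) (simp add: hist_def)
qed

locale coupled_innovations = prob_space M for M :: "'a measure" +
  fixes eps :: "int \<Rightarrow> 'a \<Rightarrow> real" and eps' :: "'a \<Rightarrow> real"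
  assumes indep: "indep_vars (\<lambda>_. borel) (\<lambda>i. case i of None \<Rightarrow> eps' | Some j \<Rightarrow> eps j) UNIV"
    and ident: "distr M borel (eps j) = distr M borel eps'"
begin

definition innovation :: "int option \<Rightarrow> 'a \<Rightarrow> real" where
  "innovation i = (case i of None \<Rightarrow> eps' | Some j \<Rightarrow> eps j)"

lemma innovation_simps[simp]: "innovation None = eps'" "innovation (Some j) = eps j"
  by (simp_all add: innovation_def)

lemma indep_innovation: "indep_vars (\<lambda>_. borel) innovation UNIV"
  using indep by (simp add: innovation_def[abs_def])

lemma measurable_innovation: "random_variable borel (innovation i)"
  using indep_innovation by (simp add: indep_vars_def2)

lemma measurable_eps[measurable]: "random_variable borel (eps j)"
  and measurable_eps'[measurable]: "random_variable borel eps'"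
  using measurable_innovation[of "Some j"] measurable_innovation[of None] by simp_all

lemma distr_innovation: "distr M borel (innovation i) = distr M borel eps'"
  by (cases i) (simp_all add: ident)

lemma distr_innovation_sequence:
  assumes "inj f"
  shows "distr M sequences (\<lambda>\<omega> j. innovation (f j) \<omega>) = PiM UNIV (\<lambda>_. distr M borel eps')"
proof -
  have "indep_vars (\<lambda>_. borel) (\<lambda>j. innovation (f j)) UNIV"
    using indep_vars_reindex[OF indep_innovation assms] by simp
  then show ?thesis
    by (subst (asm) indep_vars_iff_distr_eq_PiM)
      (simp_all add: measurable_innovation distr_innovation restrict_UNIV)
qed

lemma measurable_hist[measurable]: "hist eps k \<in> M \<rightarrow>\<^sub>M sequences"
  and measurable_hist_star[measurable]: "hist_star eps eps' k \<in> M \<rightarrow>\<^sub>M sequences"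
  by (rule measurable_sequencesI; simp add: hist_def hist_star_def)+

lemma distr_hist_star: "distr M sequences (hist_star eps eps' k) = distr M sequences (hist eps k)"
proof -
  let ?lag = "\<lambda>j. k - int j"
  have "hist eps k = (\<lambda>\<omega> j. innovation (Some (?lag j)) \<omega>)"
    by (simp add: hist_def fun_eq_iff)
  moreover have "hist_star eps eps' k
      = (\<lambda>\<omega> j. innovation (if ?lag j = 0 then None else Some (?lag j)) \<omega>)"
    by (simp add: hist_star_def fun_eq_iff)
  moreover have "inj (\<lambda>j. Some (?lag j))" "inj (\<lambda>j. if ?lag j = 0 then None else Some (?lag j))"
    by (auto simp: inj_def split: if_splits)
  ultimately show ?thesis
    by (simp only: distr_innovation_sequence)
qed

lemma AE_eq_hist_star:
  fixes f f' :: "(nat \<Rightarrow> real) \<Rightarrow> 'b::{second_countable_topology, t2_space}"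
  assumes [measurable]: "f \<in> borel_measurable sequences" "f' \<in> borel_measurable sequences"
    and AE_eq: "AE \<omega> in M. f (hist eps k \<omega>) = f' (hist eps k \<omega>)"
  shows "AE \<omega> in M. f (hist_star eps eps' k \<omega>) = f' (hist_star eps eps' k \<omega>)"
proof -
  have eq_set: "{x \<in> space sequences. f x = f' x} \<in> sets sequences"
    by (rule measurable_equality_set) measurable
  have "AE x in distr M sequences (hist eps k). f x = f' x"
    using AE_eq by (subst AE_distr_iff[OF measurable_hist eq_set])
  then have "AE x in distr M sequences (hist_star eps eps' k). f x = f' x"
    by (simp only: distr_hist_star)
  then show ?thesis
    by (subst (asm) AE_distr_iff[OF measurable_hist_star eq_set])
qed

lemma plus_innovation_hist_star:
  assumes "0 < k"
  shows "plus_innovation y (hist_star eps eps' k \<omega>) = eps k \<omega> + y (hist_star eps eps' (k - 1) \<omega>)"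
proof -
  have "(\<lambda>j. hist_star eps eps' k \<omega> (Suc j)) = hist_star eps eps' (k - 1) \<omega>"
    by (auto simp: hist_star_def fun_eq_iff diff_diff_eq)
  with assms show ?thesis
    by (simp only: plus_innovation_def) (simp add: hist_star_def)
qed

definition coupling_sq_distance :: "((nat \<Rightarrow> real) \<Rightarrow> complex) \<Rightarrow> ennreal" where
  "coupling_sq_distance f =
    (\<integral>\<^sup>+\<omega>. ennreal ((cmod (f (hist eps 0 \<omega>) - f (hist_star eps eps' 0 \<omega>)))\<^sup>2) \<partial>M)"

definition coupling_moment :: "real \<Rightarrow> int \<Rightarrow> ((nat \<Rightarrow> real) \<Rightarrow> real) \<Rightarrow> ennreal" where
  "coupling_moment \<alpha> k f =
    (\<integral>\<^sup>+\<omega>. ennreal (\<bar>f (hist eps k \<omega>) - f (hist_star eps eps' k \<omega>)\<bar> powr \<alpha>) \<partial>M)"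

lemma coupling_sq_distance_mult_left:
  assumes [measurable]: "f \<in> borel_measurable sequences"
    and "AE \<omega> in M. h (hist eps 0 \<omega>) = c * f (hist eps 0 \<omega>)"
    and "AE \<omega> in M. h (hist_star eps eps' 0 \<omega>) = c * f (hist_star eps eps' 0 \<omega>)"
  shows "coupling_sq_distance h = ennreal ((cmod c)\<^sup>2) * coupling_sq_distance f"
proof -
  have "coupling_sq_distance h = (\<integral>\<^sup>+\<omega>. ennreal ((cmod c)\<^sup>2) *
      ennreal ((cmod (f (hist eps 0 \<omega>) - f (hist_star eps eps' 0 \<omega>)))\<^sup>2) \<partial>M)"
    unfolding coupling_sq_distance_def
  proof (rule nn_integral_cong_AE)
    show "AE \<omega> in M. ennreal ((cmod (h (hist eps 0 \<omega>) - h (hist_star eps eps' 0 \<omega>)))\<^sup>2)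
        = ennreal ((cmod c)\<^sup>2) * ennreal ((cmod (f (hist eps 0 \<omega>) - f (hist_star eps eps' 0 \<omega>)))\<^sup>2)"
      using assms(2,3) by eventually_elim
        (simp add: norm_mult power_mult_distrib flip: ennreal_mult right_diff_distrib)
  qed
  also have "\<dots> = ennreal ((cmod c)\<^sup>2) * coupling_sq_distance f"
    unfolding coupling_sq_distance_def by (rule nn_integral_cmult) measurable
  finally show ?thesis .
qed

lemma coupling_moment_plus_innovation:
  assumes "0 < k"
    and "AE \<omega> in M. g (hist eps k \<omega>) = plus_innovation y (hist eps k \<omega>)"
    and "AE \<omega> in M. g (hist_star eps eps' k \<omega>) = plus_innovation y (hist_star eps eps' k \<omega>)"
  shows "coupling_moment \<alpha> k g = coupling_moment \<alpha> (k - 1) y"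
  unfolding coupling_moment_def
proof (rule nn_integral_cong_AE)
  show "AE \<omega> in M. ennreal (\<bar>g (hist eps k \<omega>) - g (hist_star eps eps' k \<omega>)\<bar> powr \<alpha>)
      = ennreal (\<bar>y (hist eps (k - 1) \<omega>) - y (hist_star eps eps' (k - 1) \<omega>)\<bar> powr \<alpha>)"
    using assms(2,3) by eventually_elim
      (simp add: plus_innovation_hist plus_innovation_hist_star[OF \<open>0 < k\<close>])
qed

definition future :: "'a \<Rightarrow> nat \<Rightarrow> real" where
  "future \<omega> = (\<lambda>j. eps (int j + 1) \<omega>)"

lemma measurable_future[measurable]: "future \<in> M \<rightarrow>\<^sub>M sequences"
  unfolding future_def by (rule measurable_sequencesI) measurable

lemma hist_eq_extend_history: "hist eps (int m) \<omega> = extend_history m (hist eps 0 \<omega>) (future \<omega>)"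
  by (auto simp: extend_history_def hist_def future_def fun_eq_iff)

lemma hist_star_eq_extend_history:
  "hist_star eps eps' (int m) \<omega> = extend_history m (hist_star eps eps' 0 \<omega>) (future \<omega>)"
  by (auto simp: extend_history_def hist_star_def future_def fun_eq_iff)

lemma indep_pair_histories_future:
  "indep_pair (sequences \<Otimes>\<^sub>M sequences) (\<lambda>\<omega>. (hist eps 0 \<omega>, hist_star eps eps' 0 \<omega>))
    sequences future"
proof -
  let ?past = "insert None (Some ` {..0}) :: int option set"
  let ?fut = "Some ` {1..} :: int option set"
  let ?histories = "\<lambda>u. (\<lambda>j. u (Some (- int j)), \<lambda>j. u (if j = 0 then None else Some (- int j)))"
  let ?shift = "\<lambda>u j. u (Some (int j + 1))"
  have "?histories \<in> PiM ?past (\<lambda>_. borel) \<rightarrow>\<^sub>M sequences \<Otimes>\<^sub>M sequences"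
    by (intro measurable_Pair measurable_sequencesI measurable_component_singleton) auto
  moreover have "?shift \<in> PiM ?fut (\<lambda>_. borel) \<rightarrow>\<^sub>M sequences"
    by (intro measurable_sequencesI measurable_component_singleton) auto
  ultimately have "indep_pair
      (sequences \<Otimes>\<^sub>M sequences) (\<lambda>\<omega>. ?histories (restrict (\<lambda>i. innovation i \<omega>) ?past))
      sequences (\<lambda>\<omega>. ?shift (restrict (\<lambda>i. innovation i \<omega>) ?fut))"
    by (intro indep_pair_blocks[OF indep_innovation]) auto
  moreover have "?histories (restrict (\<lambda>i. innovation i \<omega>) ?past)
      = (hist eps 0 \<omega>, hist_star eps eps' 0 \<omega>)" for \<omega>
    by (auto simp: hist_def hist_star_def fun_eq_iff)
  moreover have "(\<lambda>\<omega>. ?shift (restrict (\<lambda>i. innovation i \<omega>) ?fut)) = future"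
    by (auto simp: future_def fun_eq_iff)
  ultimately show ?thesis by simp
qed

lemma indep_var_eps_extend_history:
  assumes [measurable]: "y \<in> borel_measurable sequences"
  shows "indep_var borel (eps (int m + 1)) borel (\<lambda>\<omega>. y (extend_history m x (future \<omega>)))"
proof -
  let ?last = "{Some (int m + 1)} :: int option set"
  let ?between = "Some ` {1..int m} :: int option set"
  let ?extend = "\<lambda>u. extend_history m x (\<lambda>j. u (Some (int j + 1)))"
  have "?extend \<in> PiM ?between (\<lambda>_. borel) \<rightarrow>\<^sub>M sequences"
  proof (rule measurable_sequencesI)
    show "(\<lambda>u. ?extend u j) \<in> borel_measurable (PiM ?between (\<lambda>_. borel))" for j
      by (cases "j < m") (auto simp: extend_history_def intro!: measurable_component_singleton)
  qed
  then have [measurable]: "(\<lambda>u. y (?extend u)) \<in> borel_measurable (PiM ?between (\<lambda>_. borel))"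
    by measurable
  have "indep_pair borel (\<lambda>\<omega>. restrict (\<lambda>i. innovation i \<omega>) ?last (Some (int m + 1)))
      borel (\<lambda>\<omega>. y (?extend (restrict (\<lambda>i. innovation i \<omega>) ?between)))"
    by (intro indep_pair_blocks[OF indep_innovation, where f="\<lambda>u. u (Some (int m + 1))"]
        measurable_component_singleton) auto
  moreover have "?extend (restrict (\<lambda>i. innovation i \<omega>) ?between)
      = extend_history m x (future \<omega>)" for \<omega>
    by (auto simp: extend_history_def future_def fun_eq_iff)
  ultimately show ?thesis
    by (simp add: indep_pair_eq_indep_var)
qed

section \<open>Conditional characteristic functions given the history at time zero\<close>

definition cond_char :: "nat \<Rightarrow> ((nat \<Rightarrow> real) \<Rightarrow> real) \<Rightarrow> (nat \<Rightarrow> real) \<Rightarrow> real \<Rightarrow> complex" where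
  "cond_char m f x = char (distr M borel (\<lambda>\<omega>. f (extend_history m x (future \<omega>))))"

lemma cond_char_eq_expectation_cis:
  assumes [measurable]: "f \<in> borel_measurable sequences"
  shows "cond_char m f x \<theta> = expectation (\<lambda>\<omega>. cis (\<theta> * f (extend_history m x (future \<omega>))))"
  unfolding cond_char_def by (rule char_distr_eq_expectation_cis) measurable

lemma borel_measurable_cond_char[measurable]:
  assumes [measurable]: "f \<in> borel_measurable sequences"
  shows "(\<lambda>x. cond_char m f x \<theta>) \<in> borel_measurable sequences"
  unfolding cond_char_eq_expectation_cis[OF assms] by measurable

lemma complex_cond_exp_cis_hist:
  assumes [measurable]: "f \<in> borel_measurable sequences"
  shows "AE \<omega> in M. complex_cond_exp M (gen_sigma M (hist eps 0))
      (\<lambda>\<omega>. cis (\<theta> * f (hist eps (int m) \<omega>))) \<omega>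
    = cond_char m f (hist eps 0 \<omega>) \<theta>"
proof -
  have "indep_pair sequences (hist eps 0) sequences future"
    using indep_pair_compose[OF indep_pair_histories_future measurable_fst measurable_ident] by simp
  from complex_cond_exp_indep_pair[OF this, of "\<lambda>(x, v). cis (\<theta> * f (extend_history m x v))"]
  show ?thesis
    by (simp add: gen_sigma_def cond_char_eq_expectation_cis hist_eq_extend_history integrable_cis)
qed

lemma cond_char_plus_innovation:
  assumes [measurable]: "y \<in> borel_measurable sequences"
  shows "cond_char (Suc m) (plus_innovation y) x \<theta>
    = char (distr M borel eps') \<theta> * cond_char m y x \<theta>"
  using char_distr_add[OF indep_var_eps_extend_history[OF assms]]
  by (simp add: cond_char_def plus_innovation_extend_history future_def ident)

lemma coupling_sq_distance_cond_char_le: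
  assumes y[measurable]: "y \<in> borel_measurable sequences" and \<alpha>: "0 \<le> \<alpha>" "\<alpha> \<le> 2"
  shows "coupling_sq_distance (\<lambda>x. cond_char m y x \<theta>)
    \<le> ennreal (4 * \<bar>\<theta>\<bar> powr \<alpha>) * coupling_moment \<alpha> (int m) y"
proof -
  let ?past = "\<lambda>\<omega>. (hist eps 0 \<omega>, hist_star eps eps' 0 \<omega>)"
  define distance where "distance p = ennreal (\<bar>y (extend_history m (fst (fst p)) (snd p))
      - y (extend_history m (snd (fst p)) (snd p))\<bar> powr \<alpha>)" for p
  have [measurable]: "distance \<in> borel_measurable ((sequences \<Otimes>\<^sub>M sequences) \<Otimes>\<^sub>M sequences)"
    unfolding distance_def by measurable
  have "ennreal ((cmod (cond_char m y x \<theta> - cond_char m y x' \<theta>))\<^sup>2)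
      \<le> ennreal (4 * \<bar>\<theta>\<bar> powr \<alpha>) * (\<integral>\<^sup>+\<omega>'. distance ((x, x'), future \<omega>') \<partial>M)" for x x'
    unfolding cond_char_def distance_def fst_conv snd_conv
    by (intro cmod_char_diff_square_le \<alpha>) measurable
  then have "coupling_sq_distance (\<lambda>x. cond_char m y x \<theta>)
      \<le> (\<integral>\<^sup>+\<omega>. ennreal (4 * \<bar>\<theta>\<bar> powr \<alpha>) * (\<integral>\<^sup>+\<omega>'. distance (?past \<omega>, future \<omega>') \<partial>M) \<partial>M)"
    unfolding coupling_sq_distance_def by (intro nn_integral_mono)
  also have "\<dots> = ennreal (4 * \<bar>\<theta>\<bar> powr \<alpha>) * (\<integral>\<^sup>+\<omega>. \<integral>\<^sup>+\<omega>'. distance (?past \<omega>, future \<omega>') \<partial>M \<partial>M)"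
    by (rule nn_integral_cmult) measurable
  also have "(\<integral>\<^sup>+\<omega>. \<integral>\<^sup>+\<omega>'. distance (?past \<omega>, future \<omega>') \<partial>M \<partial>M)
      = (\<integral>\<^sup>+\<omega>. distance (?past \<omega>, future \<omega>) \<partial>M)"
    by (rule nn_integral_indep_pair[OF indep_pair_histories_future, symmetric]) measurable
  also have "\<dots> = coupling_moment \<alpha> (int m) y"
    by (simp add: coupling_moment_def distance_def hist_eq_extend_history
        hist_star_eq_extend_history)
  finally show ?thesis .
qed

section \<open>Processes that are additive in the last innovation\<close>

lemma plus_innovation_decomposition:
  assumes [measurable]: "g \<in> borel_measurable sequences"
    and Y: "Y \<in> borel_measurable (gen_sigma M (hist eps (k - 1)))"
    and decomp: "\<And>\<omega>. \<omega> \<in> space M \<Longrightarrow> g (hist eps k \<omega>) = eps k \<omega> + Y \<omega>"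
  obtains y where "y \<in> borel_measurable sequences"
    and "AE \<omega> in M. g (hist eps k \<omega>) = plus_innovation y (hist eps k \<omega>)"
    and "AE \<omega> in M. g (hist_star eps eps' k \<omega>) = plus_innovation y (hist_star eps eps' k \<omega>)"
proof -
  have "hist eps (k - 1) \<in> space M \<rightarrow> space sequences"
    by (simp add: space_PiM)
  with Y obtain y where y[measurable]: "y \<in> borel_measurable sequences"
    and Y_eq: "\<And>\<omega>. \<omega> \<in> space M \<Longrightarrow> Y \<omega> = y (hist eps (k - 1) \<omega>)"
    unfolding gen_sigma_def by (rule borel_measurable_vimage_algebraE) blast
  have g_eq: "AE \<omega> in M. g (hist eps k \<omega>) = plus_innovation y (hist eps k \<omega>)"
    using decomp Y_eq by (intro AE_I2) (simp add: plus_innovation_hist)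
  \<comment> \<open>The decomposition is only assumed for the original process; it is a property of the law of the
    history, which the coupled history shares.\<close>
  have "AE \<omega> in M. g (hist_star eps eps' k \<omega>) = plus_innovation y (hist_star eps eps' k \<omega>)"
    by (rule AE_eq_hist_star[OF _ _ g_eq]) measurable
  with y g_eq show ?thesis by (rule that)
qed

lemma cond_char_version_plus_innovation:
  assumes [measurable]: "y \<in> borel_measurable sequences" "g \<in> borel_measurable sequences"
      "h \<in> borel_measurable sequences"
    and g_eq: "AE \<omega> in M. g (hist eps (int (Suc m)) \<omega>)
        = plus_innovation y (hist eps (int (Suc m)) \<omega>)"
    and version: "AE \<omega> in M. h (hist eps 0 \<omega>) =
      complex_cond_exp M (gen_sigma M (hist eps 0)) (\<lambda>\<omega>. cis (\<theta> * g (hist eps (int (Suc m)) \<omega>))) \<omega>"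
  shows "AE \<omega> in M. h (hist eps 0 \<omega>) = char (distr M borel eps') \<theta> * cond_char m y (hist eps 0 \<omega>) \<theta>"
    and "AE \<omega> in M. h (hist_star eps eps' 0 \<omega>)
      = char (distr M borel eps') \<theta> * cond_char m y (hist_star eps eps' 0 \<omega>) \<theta>"
proof -
  interpret past: sigma_finite_subalgebra M "gen_sigma M (hist eps 0)"
    unfolding gen_sigma_def by (rule sigma_finite_subalgebra_vimage_algebra) simp
  have "AE \<omega> in M. complex_cond_exp M (gen_sigma M (hist eps 0))
        (\<lambda>\<omega>. cis (\<theta> * g (hist eps (int (Suc m)) \<omega>))) \<omega>
      = complex_cond_exp M (gen_sigma M (hist eps 0))
        (\<lambda>\<omega>. cis (\<theta> * plus_innovation y (hist eps (int (Suc m)) \<omega>))) \<omega>"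
  proof (rule past.complex_cond_exp_cong)
    show "AE \<omega> in M. cis (\<theta> * g (hist eps (int (Suc m)) \<omega>))
        = cis (\<theta> * plus_innovation y (hist eps (int (Suc m)) \<omega>))"
      using g_eq by eventually_elim (simp only:)
  qed measurable
  with version complex_cond_exp_cis_hist[OF measurable_plus_innovation[OF assms(1)], of \<theta> "Suc m"]
  show h_eq: "AE \<omega> in M. h (hist eps 0 \<omega>)
      = char (distr M borel eps') \<theta> * cond_char m y (hist eps 0 \<omega>) \<theta>"
    by eventually_elim (simp only: cond_char_plus_innovation[OF assms(1)])
  show "AE \<omega> in M. h (hist_star eps eps' 0 \<omega>)
      = char (distr M borel eps') \<theta> * cond_char m y (hist_star eps eps' 0 \<omega>) \<theta>"
    by (rule AE_eq_hist_star[OF _ _ h_eq]) measurable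
qed

lemma coupling_sq_distance_cond_char_version_le:
  assumes g: "g \<in> borel_measurable sequences" and h: "h \<in> borel_measurable sequences"
    and \<alpha>: "0 \<le> \<alpha>" "\<alpha> \<le> 2"
    and Y: "Y \<in> borel_measurable (gen_sigma M (hist eps (int (Suc m) - 1)))"
    and decomp: "\<And>\<omega>. \<omega> \<in> space M \<Longrightarrow> g (hist eps (int (Suc m)) \<omega>) = eps (int (Suc m)) \<omega> + Y \<omega>"
    and version: "AE \<omega> in M. h (hist eps 0 \<omega>) =
      complex_cond_exp M (gen_sigma M (hist eps 0)) (\<lambda>\<omega>. cis (\<theta> * g (hist eps (int (Suc m)) \<omega>))) \<omega>"
  shows "coupling_sq_distance h
    \<le> ennreal (4 * (cmod (char (distr M borel eps') \<theta>))\<^sup>2 * \<bar>\<theta>\<bar> powr \<alpha>)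
      * coupling_moment \<alpha> (int (Suc m)) g"
proof -
  let ?\<phi> = "char (distr M borel eps') \<theta>"
  obtain y where y[measurable]: "y \<in> borel_measurable sequences"
    and g_eq: "AE \<omega> in M. g (hist eps (int (Suc m)) \<omega>)
        = plus_innovation y (hist eps (int (Suc m)) \<omega>)"
      "AE \<omega> in M. g (hist_star eps eps' (int (Suc m)) \<omega>)
        = plus_innovation y (hist_star eps eps' (int (Suc m)) \<omega>)"
    by (rule plus_innovation_decomposition[OF g Y decomp])
  have "coupling_sq_distance h
      = ennreal ((cmod ?\<phi>)\<^sup>2) * coupling_sq_distance (\<lambda>x. cond_char m y x \<theta>)"
    by (rule coupling_sq_distance_mult_left)
      (use cond_char_version_plus_innovation[OF y g h g_eq(1) version] in measurable)
  also have "\<dots> \<le> ennreal ((cmod ?\<phi>)\<^sup>2) * (ennreal (4 * \<bar>\<theta>\<bar> powr \<alpha>) * coupling_moment \<alpha> (int m) y)"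
    using coupling_sq_distance_cond_char_le[OF y \<alpha>] by (rule mult_left_mono) simp
  also have "coupling_moment \<alpha> (int m) y = coupling_moment \<alpha> (int (Suc m)) g"
    using coupling_moment_plus_innovation[OF _ g_eq] by simp
  finally show ?thesis
    by (simp add: ennreal_mult ac_simps)
qed

end

section \<open>Summability of weighted integrals\<close>

lemma nn_integral_weighted_le:
  fixes u w :: "'a \<Rightarrow> real"
  assumes integrable: "integrable M (\<lambda>x. u x * w x)" and nonneg: "\<And>x. 0 \<le> u x" "\<And>x. 0 \<le> w x" "0 \<le> d"
    and bound: "\<And>x. f x \<le> ennreal (u x) * ennreal d"
  shows "(\<integral>\<^sup>+x. ennreal (w x) * f x \<partial>M) \<le> ennreal ((\<integral>x. u x * w x \<partial>M) * d)"
proof -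
  have "(\<integral>\<^sup>+x. ennreal (w x) * f x \<partial>M) \<le> (\<integral>\<^sup>+x. ennreal (u x * w x * d) \<partial>M)"
  proof (rule nn_integral_mono)
    fix x
    have "ennreal (w x) * f x \<le> ennreal (w x) * (ennreal (u x) * ennreal d)"
      using bound by (rule mult_left_mono) simp
    then show "ennreal (w x) * f x \<le> ennreal (u x * w x * d)"
      using nonneg by (simp add: ennreal_mult ac_simps)
  qed
  also have "\<dots> = ennreal ((\<integral>x. u x * w x \<partial>M) * d)"
    using integrable nonneg by (subst nn_integral_eq_integral) auto
  finally show ?thesis .
qed

lemma summable_sqrt_enn2real:
  fixes a :: "nat \<Rightarrow> ennreal" and d :: "nat \<Rightarrow> real"
  assumes bound: "\<And>k. a k \<le> ennreal (c * d k)" and nonneg: "0 \<le> c" "\<And>k. 0 \<le> d k"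
    and summable: "summable (\<lambda>k. sqrt (d k))"
  shows "summable (\<lambda>k. sqrt (enn2real (a k)))"
proof (rule summable_comparison_test')
  show "summable (\<lambda>k. sqrt c * sqrt (d k))"
    using summable by (rule summable_mult)
  show "norm (sqrt (enn2real (a k))) \<le> sqrt c * sqrt (d k)" for k
    using bound[of k] nonneg by (simp add: enn2real_leI flip: real_sqrt_mult)
qed

theorem theorem2p2:
  fixes M :: "'a measure"
    and eps :: "int \<Rightarrow> 'a \<Rightarrow> real" and eps' :: "'a \<Rightarrow> real"
    and g :: "(nat \<Rightarrow> real) \<Rightarrow> real"
    and Y :: "int \<Rightarrow> 'a \<Rightarrow> real"
    and \<alpha> :: real
    and h :: "nat \<Rightarrow> real \<Rightarrow> (nat \<Rightarrow> real) \<Rightarrow> complex"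
  assumes P: "prob_space M"
    and indep: "prob_space.indep_vars M (\<lambda>_. borel)
                  (\<lambda>i. case i of None \<Rightarrow> eps' | Some j \<Rightarrow> eps j) (UNIV :: int option set)"
    and ident: "\<And>j. distr M borel (eps j) = distr M borel eps'"
    and g_meas: "g \<in> borel_measurable (PiM UNIV (\<lambda>_. borel))"
    and alpha: "0 < \<alpha>" "\<alpha> \<le> 2"
    and Y_meas: "\<And>k. Y (k - 1) \<in> borel_measurable (gen_sigma M (hist eps (k - 1)))"
    and decomp: "\<And>k \<omega>. \<omega> \<in> space M \<Longrightarrow> g (hist eps k \<omega>) = eps k \<omega> + Y (k - 1) \<omega>"
    and charf: "integrable lborel
                  (\<lambda>t. (cmod (char (distr M borel eps') t))\<^sup>2 * (1 + t\<^sup>2) * \<bar>t\<bar> powr \<alpha>)"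
    and mom_int: "\<And>k::nat. integrable M
                  (\<lambda>\<omega>. \<bar>g (hist eps (int k) \<omega>) - g (hist_star eps eps' (int k) \<omega>)\<bar> powr \<alpha>)"
    and mom_sum: "summable (\<lambda>k::nat.
                  ((\<integral>\<omega>. \<bar>g (hist eps (int k) \<omega>) - g (hist_star eps eps' (int k) \<omega>)\<bar> powr \<alpha> \<partial>M)
                     powr (1 / \<alpha>)) powr (\<alpha> / 2))"
    and h_meas: "\<And>k \<theta>. h k \<theta> \<in> borel_measurable (PiM UNIV (\<lambda>_. borel))"
    and h_version: "\<And>k \<theta>. AE \<omega> in M. h k \<theta> (hist eps 0 \<omega>) =
                  complex_cond_exp M (gen_sigma M (hist eps 0))
                    (\<lambda>x. cis (\<theta> * g (hist eps (int k) x))) \<omega>"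
  shows "(\<forall>k\<ge>1. (\<integral>\<^sup>+\<theta>. ennreal (1 + \<theta>\<^sup>2) *
              (\<integral>\<^sup>+\<omega>. ennreal ((cmod (h k \<theta> (hist eps 0 \<omega>) - h k \<theta> (hist_star eps eps' 0 \<omega>)))\<^sup>2) \<partial>M)
            \<partial>lborel) < \<infinity>)
       \<and> summable (\<lambda>k::nat. sqrt (enn2real
            (\<integral>\<^sup>+\<theta>. ennreal (1 + \<theta>\<^sup>2) *
              (\<integral>\<^sup>+\<omega>. ennreal ((cmod (h (k + 1) \<theta> (hist eps 0 \<omega>) - h (k + 1) \<theta> (hist_star eps eps' 0 \<omega>)))\<^sup>2) \<partial>M)
            \<partial>lborel)))"
proof -
  interpret coupled_innovations M eps eps'
    using P indep ident by (intro coupled_innovations.intro coupled_innovations_axioms.intro)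
  define \<delta> where "\<delta> k = expectation (\<lambda>\<omega>.
      \<bar>g (hist eps (int k) \<omega>) - g (hist_star eps eps' (int k) \<omega>)\<bar> powr \<alpha>)" for k
  define c where "c t = 4 * (cmod (char (distr M borel eps') t))\<^sup>2 * \<bar>t\<bar> powr \<alpha>" for t
  define C where "C = (\<integral>t. c t * (1 + t\<^sup>2) \<partial>lborel)"
  define J where "J k = (\<integral>\<^sup>+\<theta>. ennreal (1 + \<theta>\<^sup>2) * coupling_sq_distance (h k \<theta>) \<partial>lborel)" for k
  have nonneg: "0 \<le> C" "0 \<le> \<delta> k" for k
    by (simp_all add: C_def c_def \<delta>_def)
  have "coupling_moment \<alpha> (int k) g = ennreal (\<delta> k)" for k
    unfolding coupling_moment_def \<delta>_def by (rule nn_integral_eq_integral[OF mom_int]) simp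
  then have "coupling_sq_distance (h (Suc m) \<theta>) \<le> ennreal (c \<theta>) * ennreal (\<delta> (Suc m))" for m \<theta>
    using coupling_sq_distance_cond_char_version_le
        [OF g_meas h_meas _ alpha(2) Y_meas decomp h_version] alpha(1)
    by (simp add: c_def del: of_nat_Suc)
  then have J_le: "J (Suc m) \<le> ennreal (C * \<delta> (Suc m))" for m
    unfolding J_def C_def using integrable_mult_right[OF charf, of 4] nonneg(2)
    by (intro nn_integral_weighted_le) (simp_all add: c_def ac_simps)
  then have "J k < \<infinity>" if "1 \<le> k" for k
    using that J_le[of "k - 1"] by (simp add: order_le_less_trans)
  moreover have "summable (\<lambda>k. sqrt (\<delta> (Suc k)))"
    using mom_sum alpha(1) nonneg(2)
    by (subst summable_Suc_iff) (simp add: powr_powr powr_half_sqrt flip: \<delta>_def)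
  then have "summable (\<lambda>k. sqrt (enn2real (J (Suc k))))"
    by (rule summable_sqrt_enn2real[OF J_le nonneg])
  ultimately show ?thesis
    by (simp add: J_def coupling_sq_distance_def)
qed

end
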